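(* Let $A\in\mathbb{C}^{n\times n}$, $\Omega\in\mathbb{C}^{d\times n}$, $\underline U_m\in\mathbb{C}^{n\times m}$, $\underline{\widehat u}_{m+1}\in\mathbb{C}^n$, $\underline{\widehat H}_m\in\mathbb{C}^{m\times m}$, $\underline c_m\in\mathbb{C}^m$, $R\in\mathbb{C}^{n\times m}$, and let $\mathbf u>0$ be the unit roundoff. Let $\varepsilon\in(0,1)$ be such that $\Omega$ is an $\varepsilon$-subspace embedding for $\mathsf{range}([\underline U_m,\underline{\widehat u}_{m+1}])$, and set $\kappa_\varepsilon:=\sqrt{1+\varepsilon}/\sqrt{1-\varepsilon}$. Suppose that (i) $(\Omega\underline U_m)^{\mathsf H}(\Omega\underline U_m)-I=\mathcal O(\mathbf u)$; (ii) $\|\underline U_m\|\le\sqrt{1+\varepsilon}$ and $\|\underline U_m^\dagger\|\le 1/\sqrt{1-\varepsilon}$ (hence $\kappa(\underline U_m)\le\kappa_\varepsilon$); (iii) $\|\underline{\widehat u}_{m+1}\|=1+\mathcal O(\mathbf u)$ and $\underline U_m^\dagger\,\underline{\widehat u}_{m+1}=\mathcal O(\mathbf u/\sqrt{1-\varepsilon})$; (iv) $A\underline U_m=\underline U_m\underline{\widehat H}_m+\underline{\widehat u}_{m+1}\underline c_m^{\mathsf H}+R$ with $R=\mathcal O(\kappa_\varepsilon\sqrt{1+\varepsilon}\,\|A\|\,\mathbf u)$ and $\underline c_m=\mathcal O(\sqrt{1+\varepsilon}\,\|A\|)$; and that $\kappa_\varepsilon\ll 1/\mathbf u$. Then there exist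 a vector $\widehat u_{m+1}\in\mathbb{C}^n$ and a matrix $E\in\mathbb{C}^{n\times n}$ with $$\widehat u_{m+1}-\underline{\widehat u}_{m+1}=\mathcal O(\kappa_\varepsilon\mathbf u),\qquad E=\mathcal O(\|A\|\,\kappa_\varepsilon^2\,\mathbf u),$$ such that $\|\widehat u_{m+1}\|=1$ and $$(A+E)\underline U_m=\underline U_m\underline{\widehat H}_m+\widehat u_{m+1}\underline c_m^{\mathsf H},\qquad \underline U_m^{\mathsf H}\widehat u_{m+1}=0.$$
   Context: $\|\cdot\|$ denotes the Euclidean norm for vectors and the spectral norm for matrices, $(\cdot)^{\mathsf H}$ the conjugate transpose, $(\cdot)^\dagger$ the Moore--Penrose pseudoinverse, and $\kappa(X)=\|X\|\,\|X^\dagger\|$. For a vector or matrix $X$ and a scalar $t\ge 0$, $X=\mathcal O(t)$ means $\|X\|\le C t$ with a (mild) constant $C$ depending only on $m$ and $n$ (for scalars, $x=1+\mathcal O(t)$ means $|x-1|\le Ct$). The hypothesis $\kappa_\varepsilon\ll 1/\mathbf u$ means that $\kappa_\varepsilon\mathbf u$ is sufficiently small, i.e. small compared with $1$ even after multiplication by such constants. A matrix $\Omega\in\mathbb{C}^{d\times n}$ is an $\varepsilon$-subspace embedding for a subspace $\mathcal W\subset\mathbb{C}^n$ if $(1-\varepsilon)\|w\|^2\le\|\Omega w\|^2\le(1+\varepsilon)\|w\|^2$ for all $w\in\mathcal W$. Underlined quantities represent those computed in floating point arithmetic in one cycle of the similarity-restoring randomized Krylov--Schur method with sketched reorthogonalization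 enabled (the randomized Arnoldi expansion followed by the correction that makes the last vector orthogonal to the previous ones); the theorem uses only the listed assumptions on them. *)

theory Defs
  imports
    Complex_Main
    "Jordan_Normal_Form.Schur_Decomposition"
begin

(* The matrices are those of Jordan_Normal_Form, whose dimensions are natural numbers, so that
   the embedding dimension d can be quantified inside the constants of the O-terms. *)

definition euclid_norm :: "complex vec \<Rightarrow> real" where
  "euclid_norm v = sqrt (\<Sum>i<dim_vec v. (cmod (v $ i))\<^sup>2)"

(* The unit ball, rather than the unit sphere, gives the value 0 also when dim_col A = 0. *)
definition spectral_norm :: "complex mat \<Rightarrow> real" where
  "spectral_norm A =
     Sup {euclid_norm (A *\<^sub>v x) | x. x \<in> carrier_vec (dim_col A) \<and> euclid_norm x \<le> 1}"

definition is_pseudoinverse :: "complex mat \<Rightarrow> complex mat \<Rightarrow> bool" where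
  "is_pseudoinverse A X \<longleftrightarrow>
     X \<in> carrier_mat (dim_col A) (dim_row A) \<and>
     A * X * A = A \<and>
     X * A * X = X \<and>
     mat_adjoint (A * X) = A * X \<and>
     mat_adjoint (X * A) = X * A"

(* Every complex matrix has exactly one matrix satisfying the four Penrose equations. *)
definition pseudoinverse :: "complex mat \<Rightarrow> complex mat" where
  "pseudoinverse A = (THE X. is_pseudoinverse A X)"

definition col_mat :: "complex vec \<Rightarrow> complex mat" where
  "col_mat v = mat_of_cols (dim_vec v) [v]"

definition mat_append_col :: "complex mat \<Rightarrow> complex vec \<Rightarrow> complex mat" where
  "mat_append_col U v = mat_of_cols (dim_row U) (cols U @ [v])"

definition mat_range :: "complex mat \<Rightarrow> complex vec set" where
  "mat_range M = {M *\<^sub>v x | x. x \<in> carrier_vec (dim_col M)}"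

definition subspace_embedding :: "real \<Rightarrow> complex mat \<Rightarrow> complex vec set \<Rightarrow> bool" where
  "subspace_embedding \<epsilon> \<Omega> W \<longleftrightarrow>
     (\<forall>w\<in>W. (1 - \<epsilon>) * (euclid_norm w)\<^sup>2 \<le> (euclid_norm (\<Omega> *\<^sub>v w))\<^sup>2 \<and>
            (euclid_norm (\<Omega> *\<^sub>v w))\<^sup>2 \<le> (1 + \<epsilon>) * (euclid_norm w)\<^sup>2)"

definition kappa_eps :: "real \<Rightarrow> real" where
  "kappa_eps \<epsilon> = sqrt (1 + \<epsilon>) / sqrt (1 - \<epsilon>)"

end

theory Submission
  imports Defs "HOL-Analysis.L2_Norm"
begin

text \<open>Take \<open>u' = w / \<parallel>w\<parallel>\<close> for \<open>w = u - U (X u)\<close>, where \<open>X\<close> is the pseudoinverse of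
  \<open>U\<close>: the vector \<open>w\<close> is orthogonal to the range of \<open>U\<close>, and \<open>\<parallel>U\<parallel> \<parallel>X u\<parallel>\<close> is of the order of
  \<open>\<kappa>\<close> times the roundoff, so \<open>\<parallel>w\<parallel>\<close> is close to 1. The relation to be restored reads
  \<open>E U = F\<close> with \<open>F = (u' - u) c\<^sup>H - R\<close>. Approximate orthonormality of the sketch makes \<open>U\<close>
  injective, hence \<open>X U = 1\<close> and \<open>E = F X\<close> is a solution.\<close>

subsection \<open>Adjoints\<close>

lemma dim_mat_adjoint [simp]:
  "dim_row (mat_adjoint A) = dim_col A" "dim_col (mat_adjoint A) = dim_row A"
  by (simp_all add: mat_adjoint_def)

lemma mat_adjoint_carrier [simp]: "A \<in> carrier_mat n m \<Longrightarrow> mat_adjoint A \<in> carrier_mat m n"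
  by (intro carrier_matI) auto

lemma index_mat_adjoint [simp]:
  "i < dim_col A \<Longrightarrow> j < dim_row A \<Longrightarrow> mat_adjoint A $$ (i, j) = conjugate (A $$ (j, i))"
  by (simp add: mat_adjoint_def mat_of_rows_def)

lemma mat_adjoint_one: "mat_adjoint (1\<^sub>m n :: complex mat) = 1\<^sub>m n"
  by (rule eq_matI) auto

lemma mat_adjoint_mult:
  fixes A B :: "complex mat"
  assumes "A \<in> carrier_mat n m" "B \<in> carrier_mat m k"
  shows "mat_adjoint (A * B) = mat_adjoint B * mat_adjoint A"
  using assms
  by (intro eq_matI) (auto simp: scalar_prod_def mult.commute intro!: sum.cong)

lemma mat_adjoint_adjoint: "mat_adjoint (mat_adjoint (A :: complex mat)) = A"
  by (rule eq_matI) auto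

text \<open>With \<open>x = U *\<^sub>v v\<close> this turns a kernel vector of the Gram matrix of
  \<open>U\<close> into a vector on which \<open>U\<close> itself vanishes. The sesquilinear product
  conjugates its second argument.\<close>

lemma adjoint_mult_cscalar_prod:
  fixes A :: "complex mat"
  assumes A: "A \<in> carrier_mat n m" and x: "x \<in> carrier_vec n" and v: "v \<in> carrier_vec m"
  shows "(mat_adjoint A *\<^sub>v x) \<bullet>c v = x \<bullet>c (A *\<^sub>v v)"
proof -
  have "(mat_adjoint A *\<^sub>v x) \<bullet>c v = (\<Sum>i<m. \<Sum>j<n. cnj (A $$ (j, i)) * x $ j * cnj (v $ i))"
    using assms by (simp add: scalar_prod_def atLeast0LessThan sum_distrib_right)
  also have "\<dots> = (\<Sum>j<n. \<Sum>i<m. cnj (A $$ (j, i)) * x $ j * cnj (v $ i))"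
    by (rule sum.swap)
  also have "\<dots> = x \<bullet>c (A *\<^sub>v v)"
    using assms
    by (auto simp: scalar_prod_def atLeast0LessThan sum_distrib_left mult_ac intro!: sum.cong)
  finally show ?thesis .
qed

subsection \<open>Euclidean and spectral norms\<close>

text \<open>Bridge to the real \<open>L2_set\<close> theory, from which monotonicity, the triangle
  inequality and Cauchy-Schwarz are taken after passing to moduli of entries.\<close>

lemma euclid_norm_L2_set: "euclid_norm v = L2_set (\<lambda>i. cmod (v $ i)) {..<dim_vec v}"
  by (simp add: euclid_norm_def L2_set_def)

lemma euclid_norm_nonneg [simp]: "0 \<le> euclid_norm v"
  by (simp add: euclid_norm_L2_set)

lemma euclid_norm_zero [simp]: "euclid_norm (0\<^sub>v n) = 0"
  by (simp add: euclid_norm_def)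

lemma euclid_norm_eq_0_iff:
  assumes "v \<in> carrier_vec n"
  shows "euclid_norm v = 0 \<longleftrightarrow> v = 0\<^sub>v n"
proof
  assume "euclid_norm v = 0"
  then have "\<forall>i<n. v $ i = 0"
    using assms by (simp add: euclid_norm_L2_set L2_set_eq_0_iff)
  then show "v = 0\<^sub>v n" using assms by (intro eq_vecI) auto
qed simp

lemma euclid_norm_triangle:
  assumes "v \<in> carrier_vec n" "w \<in> carrier_vec n"
  shows "euclid_norm (v + w) \<le> euclid_norm v + euclid_norm w"
proof -
  have "euclid_norm (v + w) \<le> L2_set (\<lambda>i. cmod (v $ i) + cmod (w $ i)) {..<n}"
    using assms by (auto simp: euclid_norm_L2_set norm_triangle_ineq intro!: L2_set_mono)
  also have "\<dots> \<le> euclid_norm v + euclid_norm w"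
    using assms by (simp add: euclid_norm_L2_set L2_set_triangle_ineq)
  finally show ?thesis .
qed

lemma euclid_norm_smult: "euclid_norm (a \<cdot>\<^sub>v v) = cmod a * euclid_norm v"
  by (auto simp: euclid_norm_L2_set norm_mult L2_set_right_distrib intro!: L2_set_cong)

lemma euclid_norm_uminus [simp]: "euclid_norm (- v) = euclid_norm v"
  by (simp add: euclid_norm_def)

lemma euclid_norm_triangle_minus:
  assumes "v \<in> carrier_vec n" "w \<in> carrier_vec n"
  shows "euclid_norm (v - w) \<le> euclid_norm v + euclid_norm w"
  using euclid_norm_triangle[of v n "- w"] assms
  by (simp add: minus_add_uminus_vec[of v n w])

lemma euclid_norm_minus_commute:
  assumes "v \<in> carrier_vec n" "w \<in> carrier_vec n"
  shows "euclid_norm (v - w) = euclid_norm (w - v)"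
  using assms by (simp add: euclid_norm_def norm_minus_commute)

lemma euclid_norm_triangle_sub:
  assumes "v \<in> carrier_vec n" "w \<in> carrier_vec n"
  shows "\<bar>euclid_norm v - euclid_norm w\<bar> \<le> euclid_norm (v - w)"
proof -
  have "v = (v - w) + w" "w = (w - v) + v"
    using assms by auto
  then have "euclid_norm v \<le> euclid_norm (v - w) + euclid_norm w"
    "euclid_norm w \<le> euclid_norm (w - v) + euclid_norm v"
    using assms by (metis euclid_norm_triangle minus_carrier_vec)+
  then show ?thesis using euclid_norm_minus_commute[OF assms] by linarith
qed

text \<open>Cauchy-Schwarz for the bilinear product, without conjugation: only moduli of entries
  enter, so the real inequality suffices.\<close>

lemma cmod_scalar_prod_le:
  assumes "v \<in> carrier_vec n" "w \<in> carrier_vec n"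
  shows "cmod (v \<bullet> w) \<le> euclid_norm v * euclid_norm w"
proof -
  have "cmod (v \<bullet> w) \<le> (\<Sum>i<n. \<bar>cmod (v $ i)\<bar> * \<bar>cmod (w $ i)\<bar>)"
    using assms norm_sum[of "\<lambda>i. v $ i * w $ i" "{..<n}"]
    by (simp add: scalar_prod_def atLeast0LessThan norm_mult)
  also have "\<dots> \<le> euclid_norm v * euclid_norm w"
    using assms L2_set_mult_ineq[of "\<lambda>i. cmod (v $ i)" "\<lambda>i. cmod (w $ i)" "{..<n}"]
    by (simp add: euclid_norm_L2_set)
  finally show ?thesis .
qed

text \<open>Cauchy-Schwarz applied to each row. The crude Frobenius bound serves only to show that
  the supremum defining \<open>spectral_norm\<close> is taken over a bounded set.\<close>

lemma euclid_norm_mult_mat_vec_le_Frobenius: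
  assumes "v \<in> carrier_vec (dim_col A)"
  shows "euclid_norm (A *\<^sub>v v)
    \<le> L2_set (\<lambda>i. euclid_norm (row A i)) {..<dim_row A} * euclid_norm v"
proof -
  have "euclid_norm (A *\<^sub>v v)
      \<le> L2_set (\<lambda>i. euclid_norm (row A i) * euclid_norm v) {..<dim_row A}"
    using assms cmod_scalar_prod_le[of "row A _" "dim_col A" v]
    by (auto simp: euclid_norm_L2_set[of "A *\<^sub>v v"] intro!: L2_set_mono)
  then show ?thesis by (simp add: L2_set_left_distrib)
qed

lemma bdd_above_spectral_norm:
  "bdd_above {euclid_norm (A *\<^sub>v x) | x. x \<in> carrier_vec (dim_col A) \<and> euclid_norm x \<le> 1}"
proof (rule bdd_aboveI)
  fix y
  assume "y \<in> {euclid_norm (A *\<^sub>v x) | x. x \<in> carrier_vec (dim_col A) \<and> euclid_norm x \<le> 1}"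
  then obtain x where x: "x \<in> carrier_vec (dim_col A)" "euclid_norm x \<le> 1"
    and y: "y = euclid_norm (A *\<^sub>v x)" by auto
  let ?F = "L2_set (\<lambda>i. euclid_norm (row A i)) {..<dim_row A}"
  have "y \<le> ?F * euclid_norm x"
    using euclid_norm_mult_mat_vec_le_Frobenius[OF x(1)] y by simp
  also have "\<dots> \<le> ?F * 1" using x(2) by (intro mult_left_mono) auto
  finally show "y \<le> ?F" by simp
qed

lemma spectral_norm_nonneg [simp]: "0 \<le> spectral_norm A"
proof -
  have "euclid_norm (A *\<^sub>v 0\<^sub>v (dim_col A)) \<le> spectral_norm A"
    unfolding spectral_norm_def
    by (rule cSup_upper[OF _ bdd_above_spectral_norm]) force
  then show ?thesis using euclid_norm_nonneg order_trans by blast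
qed

text \<open>By homogeneity: a nonzero \<open>v\<close> is scaled to a unit vector, which belongs to
  the set whose supremum is \<open>spectral_norm A\<close>.\<close>

lemma euclid_norm_mult_mat_vec_le:
  assumes A: "A \<in> carrier_mat n m" and v: "v \<in> carrier_vec m"
  shows "euclid_norm (A *\<^sub>v v) \<le> spectral_norm A * euclid_norm v"
proof (cases "v = 0\<^sub>v m")
  case True
  have "A *\<^sub>v 0\<^sub>v m = 0\<^sub>v n" using A by auto
  then show ?thesis using True by simp
next
  case False
  define r where "r = euclid_norm v"
  have r: "r > 0"
    using False euclid_norm_eq_0_iff[OF v] euclid_norm_nonneg[of v] unfolding r_def by linarith
  let ?x = "complex_of_real (1 / r) \<cdot>\<^sub>v v"
  have "euclid_norm ?x = 1"
    using r by (simp add: euclid_norm_smult norm_divide flip: r_def)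
  then have "euclid_norm (A *\<^sub>v ?x) \<le> spectral_norm A"
    unfolding spectral_norm_def
    using A v by (intro cSup_upper[OF _ bdd_above_spectral_norm]) force
  moreover have "A *\<^sub>v ?x = complex_of_real (1 / r) \<cdot>\<^sub>v (A *\<^sub>v v)"
    using A v by (rule mult_mat_vec)
  ultimately have "euclid_norm (A *\<^sub>v v) / r \<le> spectral_norm A"
    using r by (simp add: euclid_norm_smult norm_divide)
  then show ?thesis using r by (simp add: r_def divide_le_eq)
qed

lemma spectral_norm_le:
  assumes A: "A \<in> carrier_mat n m" and "0 \<le> K"
    and K: "\<And>x. x \<in> carrier_vec m \<Longrightarrow> euclid_norm (A *\<^sub>v x) \<le> K * euclid_norm x"
  shows "spectral_norm A \<le> K"
  unfolding spectral_norm_def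
proof (rule cSup_least)
  show "{euclid_norm (A *\<^sub>v x) | x. x \<in> carrier_vec (dim_col A) \<and> euclid_norm x \<le> 1} \<noteq> {}"
    \<comment> \<open>The zero vector lies in the unit ball in every dimension, including 0.\<close>
    using zero_carrier_vec[of "dim_col A"] euclid_norm_zero[of "dim_col A"] by fastforce
next
  fix y
  assume "y \<in> {euclid_norm (A *\<^sub>v x) | x. x \<in> carrier_vec (dim_col A) \<and> euclid_norm x \<le> 1}"
  then obtain x where x: "x \<in> carrier_vec m" "euclid_norm x \<le> 1"
    and y: "y = euclid_norm (A *\<^sub>v x)" using A by auto
  have "y \<le> K * euclid_norm x" using K x y by simp
  also have "\<dots> \<le> K * 1" using x \<open>0 \<le> K\<close> by (intro mult_left_mono)
  finally show "y \<le> K" by simp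
qed

subsection \<open>The pseudoinverse of a matrix of full column rank\<close>

text \<open>Penrose's argument: \<open>A * X = A * Y\<close> and \<open>X * A = Y * A\<close>,
  whence \<open>X = X * A * X = Y * A * X = Y * A * Y = Y\<close>. It allows the description in
  \<open>pseudoinverse\<close> to be evaluated at any known solution.\<close>

lemma is_pseudoinverse_unique:
  assumes X: "is_pseudoinverse A X" and Y: "is_pseudoinverse A Y"
  shows "X = Y"
proof -
  obtain n m where A [simp]: "A \<in> carrier_mat n m" by auto
  have [simp]: "X \<in> carrier_mat m n" "Y \<in> carrier_mat m n"
    using X Y A by (auto simp: is_pseudoinverse_def)
  have [simp]: "A * X \<in> carrier_mat n n" "A * Y \<in> carrier_mat n n"
    "X * A \<in> carrier_mat m m" "Y * A \<in> carrier_mat m m"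
    by (auto intro: mult_carrier_mat[of _ _ m] mult_carrier_mat[of _ _ n])
  \<comment> \<open>Since \<open>A * Y * A = A\<close>. Taking adjoints reverses the order of the
    two Hermitian factors, and the reversed product collapses to \<open>A * Y\<close> by
    \<open>A * X * A = A\<close>.\<close>
  have "A * X = A * Y * (A * X)"
    using Y by (simp add: is_pseudoinverse_def flip: assoc_mult_mat[of _ n n _ m _ n])
  then have "mat_adjoint (A * X) = mat_adjoint (A * Y * (A * X))" by simp
  then have "A * X = A * X * (A * Y)"
    using X Y by (simp add: is_pseudoinverse_def mat_adjoint_mult[of _ n n _ n])
  then have AX: "A * X = A * Y"
    using X by (simp add: is_pseudoinverse_def flip: assoc_mult_mat[of _ n n _ m _ n])
  have "A * (Y * A) = A" "A * (X * A) = A"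
    using X Y by (simp_all add: is_pseudoinverse_def flip: assoc_mult_mat[of A n m _ n A m])
  then have absorb: "X * A * (Y * A) = X * A" "Y * A * (X * A) = Y * A"
    by (simp_all add: assoc_mult_mat[of _ m n A m _ m])
  from absorb(1) have "X * A = X * A * (Y * A)" ..
  then have "mat_adjoint (X * A) = mat_adjoint (X * A * (Y * A))" by simp
  then have "X * A = Y * A * (X * A)"
    using X Y by (simp add: is_pseudoinverse_def mat_adjoint_mult[of _ m m _ m])
  then have XA: "X * A = Y * A" using absorb(2) by simp
  have "X = X * A * X" using X by (simp add: is_pseudoinverse_def)
  also have "\<dots> = Y * (A * X)" by (simp add: XA assoc_mult_mat[of Y m n A m X n])
  also have "\<dots> = Y * A * Y" by (simp add: AX assoc_mult_mat[of Y m n A m Y n])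
  also have "\<dots> = Y" using Y by (simp add: is_pseudoinverse_def)
  finally show ?thesis .
qed

lemma pseudoinverse_eqI: "is_pseudoinverse A X \<Longrightarrow> pseudoinverse A = X"
  unfolding pseudoinverse_def using is_pseudoinverse_unique by blast

text \<open>For an injective \<open>U\<close> the Gram matrix \<open>G\<close> is invertible, and
  its inverse \<open>B\<close> times the adjoint of \<open>U\<close> satisfies the Penrose
  equations; by uniqueness it is the pseudoinverse.\<close>

lemma pseudoinverse_full_column_rank:
  assumes U: "U \<in> carrier_mat n m"
    and inj: "\<And>v. v \<in> carrier_vec m \<Longrightarrow> U *\<^sub>v v = 0\<^sub>v n \<Longrightarrow> v = 0\<^sub>v m"
  shows "is_pseudoinverse U (pseudoinverse U)" "pseudoinverse U * U = 1\<^sub>m m"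
proof -
  note U [simp]
  define G where "G = mat_adjoint U * U"
  have G [simp]: "G \<in> carrier_mat m m"
    using U by (auto simp: G_def intro: mult_carrier_mat[of _ _ n])
  \<comment> \<open>The Gram matrix has trivial kernel: pairing \<open>G *\<^sub>v v\<close> with
    \<open>v\<close> gives the squared norm of \<open>U *\<^sub>v v\<close>.\<close>
  have "v = 0\<^sub>v m" if v: "v \<in> carrier_vec m" and "G *\<^sub>v v = 0\<^sub>v m" for v
  proof -
    have Uv: "U *\<^sub>v v \<in> carrier_vec n" using v by (rule mult_mat_vec_carrier[OF U])
    have "mat_adjoint U *\<^sub>v (U *\<^sub>v v) = 0\<^sub>v m"
      using that assoc_mult_mat_vec[OF mat_adjoint_carrier[OF U] U v] by (simp add: G_def)
    then have "(U *\<^sub>v v) \<bullet>c (U *\<^sub>v v) = 0"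
      using adjoint_mult_cscalar_prod[OF U Uv v] v by simp
    then have "U *\<^sub>v v = 0\<^sub>v n" using conjugate_square_eq_0_vec[OF Uv] by simp
    then show ?thesis using inj v by blast
  qed
  then have "det G \<noteq> 0" using det_0_iff_vec_prod_zero_field[OF G] by blast
  then have "G \<in> Units (ring_mat TYPE(complex) m ())" by (rule det_non_zero_imp_unit[OF G])
  then obtain B where B [simp]: "B \<in> carrier_mat m m" and BG: "B * G = 1\<^sub>m m" and GB: "G * B = 1\<^sub>m m"
    unfolding Units_def ring_mat_def by auto
  have "mat_adjoint G = G"
    by (simp add: G_def mat_adjoint_mult[of _ m n _ m] mat_adjoint_adjoint)
  \<comment> \<open>The inverse of a Hermitian matrix is Hermitian: the adjoint of \<open>B\<close>
    is a left inverse of \<open>G\<close>, and multiplying by \<open>B\<close> on the right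
    identifies it with \<open>B\<close>. This is what makes \<open>U * X\<close> Hermitian
    below.\<close>
  then have "mat_adjoint B * G = 1\<^sub>m m"
    using mat_adjoint_mult[OF G B] GB by (simp add: mat_adjoint_one)
  then have "mat_adjoint B * G * B = B" by (simp add: left_mult_one_mat[OF B])
  then have Badj: "mat_adjoint B = B"
    using GB right_mult_one_mat[of "mat_adjoint B" m m]
    by (simp add: assoc_mult_mat[of "mat_adjoint B" m m G m B m])
  define X where "X = B * mat_adjoint U"
  have X [simp]: "X \<in> carrier_mat m n"
    using U B by (auto simp: X_def intro: mult_carrier_mat[of _ _ m])
  have XU: "X * U = 1\<^sub>m m"
    using BG by (simp add: X_def G_def assoc_mult_mat[of B m m "mat_adjoint U" n U m])
  have "mat_adjoint (U * X) = mat_adjoint X * mat_adjoint U"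
    by (simp add: mat_adjoint_mult[of _ n m _ n])
  also have "mat_adjoint X = U * B"
    by (simp add: X_def mat_adjoint_mult[of _ m m _ n] Badj mat_adjoint_adjoint)
  also have "\<dots> * mat_adjoint U = U * X"
    by (simp add: X_def assoc_mult_mat[of U n m B m "mat_adjoint U" n])
  finally have UX: "mat_adjoint (U * X) = U * X" .
  have pX: "is_pseudoinverse U X"
    unfolding is_pseudoinverse_def
    using UX right_mult_one_mat[OF U] left_mult_one_mat[OF X]
    by (simp add: XU mat_adjoint_one assoc_mult_mat[of U n m X n U m] carrier_matD[OF U])
  then have "pseudoinverse U = X" by (rule pseudoinverse_eqI)
  then show "is_pseudoinverse U (pseudoinverse U)" "pseudoinverse U * U = 1\<^sub>m m"
    using pX XU by simp_all
qed

text \<open>Adjoint of \<open>U * X * U = U\<close>, using that \<open>U * X\<close> is Hermitian.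
  Consequently \<open>u - U *\<^sub>v (X *\<^sub>v u)\<close> is orthogonal to the range of
  \<open>U\<close>.\<close>

lemma adjoint_mult_range_projection:
  assumes U: "U \<in> carrier_mat n m" and X: "is_pseudoinverse U X"
  shows "mat_adjoint U * (U * X) = mat_adjoint U"
proof -
  have X': "X \<in> carrier_mat m n" using X U by (auto simp: is_pseudoinverse_def)
  have UX: "U * X \<in> carrier_mat n n" using U X' by auto
  have "mat_adjoint U = mat_adjoint (U * X * U)" using X by (simp add: is_pseudoinverse_def)
  also have "\<dots> = mat_adjoint U * (U * X)"
    using X mat_adjoint_mult[OF UX U] by (simp add: is_pseudoinverse_def)
  finally show ?thesis ..
qed

text \<open>On a kernel vector of \<open>W\<close> the deviation of the Gram matrix from the
  identity acts as \<open>-1\<close>, so a nonzero kernel vector would force its spectral norm to be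
  at least 1.\<close>

lemma injective_if_near_identity:
  assumes W: "W \<in> carrier_mat d m" and small: "spectral_norm (mat_adjoint W * W - 1\<^sub>m m) < 1"
    and v: "v \<in> carrier_vec m" and Wv: "W *\<^sub>v v = 0\<^sub>v d"
  shows "v = 0\<^sub>v m"
proof (rule ccontr)
  assume "v \<noteq> 0\<^sub>v m"
  then have pos: "euclid_norm v > 0"
    using euclid_norm_eq_0_iff[OF v] euclid_norm_nonneg[of v] by linarith
  let ?M = "mat_adjoint W * W"
  have M: "?M \<in> carrier_mat m m" using W by (auto intro: mult_carrier_mat[of _ _ d])
  have "mat_adjoint W *\<^sub>v 0\<^sub>v d = 0\<^sub>v m" using W by auto
  then have "?M *\<^sub>v v = 0\<^sub>v m"
    using assoc_mult_mat_vec[OF mat_adjoint_carrier[OF W] W v] Wv by simp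
  then have "(?M - 1\<^sub>m m) *\<^sub>v v = - v"
    using minus_mult_distrib_mat_vec[OF M one_carrier_mat v] v by auto
  then have "euclid_norm v \<le> spectral_norm (?M - 1\<^sub>m m) * euclid_norm v"
    using euclid_norm_mult_mat_vec_le[of "?M - 1\<^sub>m m" m m v] v
    by (simp add: minus_carrier_mat[OF one_carrier_mat])
  then show False using small pos by simp
qed

subsection \<open>Rank-one matrices\<close>

lemma dim_col_mat [simp]: "dim_row (col_mat v) = dim_vec v" "dim_col (col_mat v) = 1"
  by (simp_all add: col_mat_def)

lemma rank_one_carrier [simp]:
  "u \<in> carrier_vec n \<Longrightarrow> c \<in> carrier_vec m
    \<Longrightarrow> col_mat u * mat_adjoint (col_mat c) \<in> carrier_mat n m"
  by (intro carrier_matI) auto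

lemma index_rank_one:
  assumes "u \<in> carrier_vec n" "c \<in> carrier_vec m" "i < n" "j < m"
  shows "(col_mat u * mat_adjoint (col_mat c)) $$ (i, j) = u $ i * cnj (c $ j)"
  using assms by (simp add: col_mat_def scalar_prod_def mat_of_cols_def)

lemma rank_one_diff:
  assumes "u \<in> carrier_vec n" "v \<in> carrier_vec n" "c \<in> carrier_vec m"
  shows "col_mat (u - v) * mat_adjoint (col_mat c)
    = col_mat u * mat_adjoint (col_mat c) - col_mat v * mat_adjoint (col_mat c)"
proof (rule eq_matI)
  fix i j
  assume "i < dim_row (col_mat u * mat_adjoint (col_mat c) - col_mat v * mat_adjoint (col_mat c))"
    "j < dim_col (col_mat u * mat_adjoint (col_mat c) - col_mat v * mat_adjoint (col_mat c))"
  then have "i < n" "j < m" using assms by auto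
  then show "(col_mat (u - v) * mat_adjoint (col_mat c)) $$ (i, j) =
    (col_mat u * mat_adjoint (col_mat c) - col_mat v * mat_adjoint (col_mat c)) $$ (i, j)"
    using assms
    by (simp add: index_rank_one[of _ n c m] left_diff_distrib del: index_mult_mat(1))
qed (use assms in auto)

text \<open>The matrix sends \<open>x\<close> to \<open>u\<close> scaled by the inner product of
  \<open>x\<close> with \<open>c\<close>, which Cauchy-Schwarz bounds.\<close>

lemma euclid_norm_rank_one_mult_le:
  assumes u: "u \<in> carrier_vec n" and c: "c \<in> carrier_vec m" and x: "x \<in> carrier_vec m"
  shows "euclid_norm (col_mat u * mat_adjoint (col_mat c) *\<^sub>v x)
    \<le> euclid_norm u * euclid_norm c * euclid_norm x"
proof -
  let ?P = "col_mat u * mat_adjoint (col_mat c)"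
  have P: "?P \<in> carrier_mat n m" using u c by simp
  have "?P *\<^sub>v x = (conjugate c \<bullet> x) \<cdot>\<^sub>v u"
  proof (rule eq_vecI)
    fix i assume "i < dim_vec ((conjugate c \<bullet> x) \<cdot>\<^sub>v u)"
    then have i: "i < n" using u by simp
    then have "(?P *\<^sub>v x) $ i = (\<Sum>j<m. ?P $$ (i, j) * x $ j)"
      using u c x by (simp add: scalar_prod_def atLeast0LessThan del: index_mult_mat(1))
    also have "\<dots> = (\<Sum>j<m. u $ i * cnj (c $ j) * x $ j)"
      by (rule sum.cong) (simp_all add: index_rank_one[OF u c i] del: index_mult_mat(1))
    also have "\<dots> = ((conjugate c \<bullet> x) \<cdot>\<^sub>v u) $ i"
      using u c x i by (simp add: scalar_prod_def atLeast0LessThan sum_distrib_left mult_ac)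
    finally show "(?P *\<^sub>v x) $ i = ((conjugate c \<bullet> x) \<cdot>\<^sub>v u) $ i" .
  qed (use u in simp)
  moreover have "euclid_norm (conjugate c) = euclid_norm c"
    by (simp add: euclid_norm_def)
  moreover have "cmod (conjugate c \<bullet> x) \<le> euclid_norm (conjugate c) * euclid_norm x"
    using c x by (intro cmod_scalar_prod_le) auto
  ultimately show ?thesis
    using mult_right_mono[of "cmod (conjugate c \<bullet> x)" "euclid_norm c * euclid_norm x" "euclid_norm u"]
    by (simp add: euclid_norm_smult mult_ac)
qed

subsection \<open>Orthogonalization and backward error\<close>

text \<open>Removing the projection of \<open>u\<close> onto the range of \<open>U\<close> costs at
  most \<open>b\<close>. The remainder \<open>w\<close> then has norm within \<open>a + b\<close> of
  1, so normalizing it costs at most another \<open>a + b\<close>. The condition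
  \<open>a + b < 1\<close> keeps \<open>w\<close> nonzero.\<close>

lemma orthogonalize_normalize:
  assumes U: "U \<in> carrier_mat n m" and u: "u \<in> carrier_vec n"
    and X: "is_pseudoinverse U X"
    and unit: "\<bar>euclid_norm u - 1\<bar> \<le> a" and coef: "spectral_norm U * euclid_norm (X *\<^sub>v u) \<le> b"
    and small: "a + b < 1"
  shows "\<exists>u'\<in>carrier_vec n. euclid_norm u' = 1 \<and> mat_adjoint U *\<^sub>v u' = 0\<^sub>v m \<and>
    euclid_norm (u' - u) \<le> a + 2 * b"
proof -
  have X': "X \<in> carrier_mat m n" using X U by (auto simp: is_pseudoinverse_def)
  have Ua: "mat_adjoint U \<in> carrier_mat m n" using U by simp
  have Xu: "X *\<^sub>v u \<in> carrier_vec m" using X' u by auto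
  define p where "p = U *\<^sub>v (X *\<^sub>v u)"
  have p: "p \<in> carrier_vec n" using U X' u by (auto simp: p_def)
  have np: "euclid_norm p \<le> b"
    using euclid_norm_mult_mat_vec_le[OF U Xu] coef by (simp add: p_def)
  define w where "w = u - p"
  have w: "w \<in> carrier_vec n" using u p by (simp add: w_def)
  have "mat_adjoint U *\<^sub>v p = (mat_adjoint U * (U * X)) *\<^sub>v u"
    using U X' u Ua by (simp add: p_def assoc_mult_mat_vec[of _ m n _ n] assoc_mult_mat_vec[of _ n m _ n])
  then have "mat_adjoint U *\<^sub>v p = mat_adjoint U *\<^sub>v u"
    by (simp add: adjoint_mult_range_projection[OF U X])
  then have orth: "mat_adjoint U *\<^sub>v w = 0\<^sub>v m"
    using Ua u p by (simp add: w_def mult_minus_distrib_mat_vec[of _ m n])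
  have wu: "euclid_norm (w - u) \<le> b"
  proof -
    have "w - u = - p" using u p by (auto simp: w_def)
    then show ?thesis using np by simp
  qed
  define r where "r = euclid_norm w"
  have r1: "\<bar>r - 1\<bar> \<le> a + b"
    using euclid_norm_triangle_sub[OF w u] wu unit unfolding r_def by linarith
  have r: "r > 0" using r1 small by linarith
  define u' where "u' = complex_of_real (1 / r) \<cdot>\<^sub>v w"
  have u': "u' \<in> carrier_vec n" using w by (simp add: u'_def)
  have "euclid_norm u' = 1"
    using r by (simp add: u'_def euclid_norm_smult norm_divide flip: r_def)
  moreover have "mat_adjoint U *\<^sub>v u' = 0\<^sub>v m"
    using orth by (auto simp: u'_def mult_mat_vec[OF Ua w])
  moreover have "euclid_norm (u' - u) \<le> a + 2 * b"
  \<comment> \<open>Rescaling \<open>w\<close>, of norm \<open>r\<close>, to norm 1 moves it by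
    exactly \<open>\<bar>1 - r\<bar>\<close>; adding the distance from \<open>w\<close> to
    \<open>u\<close> gives the second \<open>b\<close>.\<close>
  proof -
    have "u' - w = complex_of_real (1 / r - 1) \<cdot>\<^sub>v w"
      using w by (intro eq_vecI) (auto simp: u'_def algebra_simps)
    then have "euclid_norm (u' - w) = \<bar>1 / r - 1\<bar> * r"
      by (simp add: euclid_norm_smult r_def del: of_real_diff of_real_divide)
    also have "\<dots> = \<bar>1 - r\<bar>"
      using r by (simp add: abs_if field_simps)
    finally have "euclid_norm (u' - w) \<le> a + b" using r1 by linarith
    moreover have "u' - u = (u' - w) + (w - u)" using u u' w by auto
    ultimately show ?thesis
      using euclid_norm_triangle[of "u' - w" n "w - u"] u u' w wu by simp
  qed
  ultimately show ?thesis using u' by blast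
qed

text \<open>Subtracting \<open>rel\<close> from the target relation leaves \<open>E * U = F\<close>,
  which any left inverse \<open>X\<close> of \<open>U\<close> solves by \<open>E = F * X\<close>.
  The norm bound is submultiplicativity together with the rank-one estimate.\<close>

lemma backward_error:
  assumes A: "A \<in> carrier_mat n n" and U: "U \<in> carrier_mat n m" and H: "H \<in> carrier_mat m m"
    and u: "u \<in> carrier_vec n" and u': "u' \<in> carrier_vec n"
    and c: "c \<in> carrier_vec m" and R: "R \<in> carrier_mat n m"
    and X: "X \<in> carrier_mat m n" and XU: "X * U = 1\<^sub>m m"
    and rel: "A * U = U * H + col_mat u * mat_adjoint (col_mat c) + R"
  shows "\<exists>E\<in>carrier_mat n n. (A + E) * U = U * H + col_mat u' * mat_adjoint (col_mat c) \<and>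
    spectral_norm E \<le> (euclid_norm (u' - u) * euclid_norm c + spectral_norm R) * spectral_norm X"
proof
  let ?P = "col_mat (u' - u) * mat_adjoint (col_mat c)"
  let ?k = "euclid_norm (u' - u) * euclid_norm c + spectral_norm R"
  define F where "F = ?P - R"
  have P: "?P \<in> carrier_mat n m" using u u' c by simp
  have F: "F \<in> carrier_mat n m" using P R by (auto simp: F_def)
  show E: "F * X \<in> carrier_mat n n" using F X by auto
  have "(A + F * X) * U = A * U + F * (X * U)"
    using A E U F X by (simp add: add_mult_distrib_mat[of _ n n] assoc_mult_mat[of _ n m _ n])
  also have "F * (X * U) = F" using F by (simp add: XU)
  also have "A * U + F = U * H + col_mat u' * mat_adjoint (col_mat c)"
    unfolding rel F_def rank_one_diff[OF u' u c]
  proof -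
    define UH P1 P2 where "UH = U * H" and "P1 = col_mat u * mat_adjoint (col_mat c)"
      and "P2 = col_mat u' * mat_adjoint (col_mat c)"
    have "UH \<in> carrier_mat n m" "P1 \<in> carrier_mat n m" "P2 \<in> carrier_mat n m"
      using U H u u' c by (auto simp: UH_def P1_def P2_def simp del: index_mult_mat(1))
    then have "UH + P1 + R + (P2 - P1 - R) = UH + P2"
      using R by (intro eq_matI) auto
    then show "U * H + col_mat u * mat_adjoint (col_mat c) + R
        + (col_mat u' * mat_adjoint (col_mat c) - col_mat u * mat_adjoint (col_mat c) - R)
      = U * H + col_mat u' * mat_adjoint (col_mat c)"
      by (simp add: UH_def P1_def P2_def)
  qed
  finally have eq: "(A + F * X) * U = U * H + col_mat u' * mat_adjoint (col_mat c)" .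
  have "spectral_norm (F * X) \<le> ?k * spectral_norm X"
  proof (rule spectral_norm_le[OF E])
    show "0 \<le> ?k * spectral_norm X" by simp
    fix x :: "complex vec" assume x: "x \<in> carrier_vec n"
    define y where "y = X *\<^sub>v x"
    have y: "y \<in> carrier_vec m" using X x by (auto simp: y_def)
    have "F * X *\<^sub>v x = ?P *\<^sub>v y - R *\<^sub>v y"
      using F X P R x y
      by (simp add: assoc_mult_mat_vec[of _ n m _ n] F_def minus_mult_distrib_mat_vec flip: y_def)
    then have "euclid_norm (F * X *\<^sub>v x) \<le> euclid_norm (?P *\<^sub>v y) + euclid_norm (R *\<^sub>v y)"
      using P R y euclid_norm_triangle_minus[of "?P *\<^sub>v y" n "R *\<^sub>v y"] by auto
    also have "\<dots> \<le> ?k * euclid_norm y"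
      using euclid_norm_rank_one_mult_le[of "u' - u" n c m y] u u' c y
        euclid_norm_mult_mat_vec_le[OF R y] by (simp add: distrib_right)
    also have "\<dots> \<le> ?k * (spectral_norm X * euclid_norm x)"
      unfolding y_def by (intro mult_left_mono euclid_norm_mult_mat_vec_le[OF X x]) simp
    finally show "euclid_norm (F * X *\<^sub>v x) \<le> ?k * spectral_norm X * euclid_norm x"
      by (simp add: mult.assoc)
  qed
  with eq show "(A + F * X) * U = U * H + col_mat u' * mat_adjoint (col_mat c) \<and>
    spectral_norm (F * X) \<le> ?k * spectral_norm X" ..
qed

section \<open>Choice of the constants and assembly\<close>

lemma kappa_eps_ge_1: "0 < \<epsilon> \<Longrightarrow> \<epsilon> < 1 \<Longrightarrow> 1 \<le> kappa_eps \<epsilon>"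
  by (simp add: kappa_eps_def)

text \<open>The constants \<open>\<delta>\<close>, \<open>K_u\<close> and \<open>K_E\<close> are
  chosen before \<open>d\<close>, the matrices, \<open>ur\<close> and \<epsilon>, so they depend
  only on the dimensions and on the constants in the hypotheses. The bound by
  \<open>\<delta>\<close> expresses that \<open>kappa_eps \<epsilon> * ur\<close> is sufficiently
  small.\<close>

theorem theorem3p2:
  fixes m n :: nat
    and C_orth C_unit C_coef C_res C_c :: real
  shows "\<exists>\<delta>>0. \<exists>K_u\<ge>0. \<exists>K_E\<ge>0.
    \<forall>(d::nat) (A::complex mat) (\<Omega>::complex mat) (U::complex mat) (u::complex vec)
      (H::complex mat) (c::complex vec) (R::complex mat) (ur::real) (\<epsilon>::real).
      A \<in> carrier_mat n n \<longrightarrow>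
      \<Omega> \<in> carrier_mat d n \<longrightarrow>
      U \<in> carrier_mat n m \<longrightarrow>
      u \<in> carrier_vec n \<longrightarrow>
      H \<in> carrier_mat m m \<longrightarrow>
      c \<in> carrier_vec m \<longrightarrow>
      R \<in> carrier_mat n m \<longrightarrow>
      0 < ur \<longrightarrow>
      0 < \<epsilon> \<longrightarrow> \<epsilon> < 1 \<longrightarrow>
      subspace_embedding \<epsilon> \<Omega> (mat_range (mat_append_col U u)) \<longrightarrow>
      spectral_norm (mat_adjoint (\<Omega> * U) * (\<Omega> * U) - 1\<^sub>m m) \<le> C_orth * ur \<longrightarrow>
      spectral_norm U \<le> sqrt (1 + \<epsilon>) \<longrightarrow>
      spectral_norm (pseudoinverse U) \<le> 1 / sqrt (1 - \<epsilon>) \<longrightarrow>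
      \<bar>euclid_norm u - 1\<bar> \<le> C_unit * ur \<longrightarrow>
      euclid_norm (pseudoinverse U *\<^sub>v u) \<le> C_coef * (ur / sqrt (1 - \<epsilon>)) \<longrightarrow>
      A * U = U * H + col_mat u * mat_adjoint (col_mat c) + R \<longrightarrow>
      spectral_norm R \<le> C_res * (kappa_eps \<epsilon> * sqrt (1 + \<epsilon>) * spectral_norm A * ur) \<longrightarrow>
      euclid_norm c \<le> C_c * (sqrt (1 + \<epsilon>) * spectral_norm A) \<longrightarrow>
      kappa_eps \<epsilon> * ur \<le> \<delta> \<longrightarrow>
      (\<exists>u'\<in>carrier_vec n. \<exists>E\<in>carrier_mat n n.
         euclid_norm (u' - u) \<le> K_u * (kappa_eps \<epsilon> * ur) \<and>
         spectral_norm E \<le> K_E * (spectral_norm A * (kappa_eps \<epsilon>)\<^sup>2 * ur) \<and>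
         euclid_norm u' = 1 \<and>
         (A + E) * U = U * H + col_mat u' * mat_adjoint (col_mat c) \<and>
         mat_adjoint U *\<^sub>v u' = 0\<^sub>v m)"
proof -
  \<comment> \<open>This is \<open>a + 2 * b\<close> of the orthogonalization with the factor
    \<open>t\<close> taken out. Absolute values appear because the given constants are arbitrary
    reals.\<close>
  define K where "K = \<bar>C_unit\<bar> + 2 * \<bar>C_coef\<bar>"
  \<comment> \<open>Chosen so that all error terms together stay below 1/2. This covers both
    requirements: the sketched Gram matrix within distance 1 of the identity, and
    \<open>a + b < 1\<close>. The summand 1 keeps the denominator positive.\<close>
  define \<delta> where "\<delta> = 1 / (2 * (1 + \<bar>C_orth\<bar> + \<bar>C_unit\<bar> + \<bar>C_coef\<bar>))"
  \<comment> \<open>The first summand comes from the rank-one correction with \<open>c\<close>, the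
    second from the residual \<open>R\<close>.\<close>
  define K_E where "K_E = K * \<bar>C_c\<bar> + \<bar>C_res\<bar>"
  have K: "0 \<le> K" by (simp add: K_def)
  have K_E: "0 \<le> K_E" using K by (simp add: K_E_def)
  have \<delta>: "\<delta> > 0" unfolding \<delta>_def by (intro divide_pos_pos mult_pos_pos) linarith+
  have half: "(1 + \<bar>C_orth\<bar> + \<bar>C_unit\<bar> + \<bar>C_coef\<bar>) * \<delta> = 1 / 2"
    unfolding \<delta>_def by (simp add: field_simps add_pos_nonneg)
  show ?thesis
  proof (rule exI[of _ \<delta>], rule conjI[OF \<delta>], rule exI[of _ K], rule conjI[OF K],
      rule exI[of _ K_E], rule conjI[OF K_E], intro allI impI)
    fix d :: nat and A \<Omega> U H R :: "complex mat" and u c :: "complex vec" and ur \<epsilon> :: real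
    assume A: "A \<in> carrier_mat n n" and \<Omega>: "\<Omega> \<in> carrier_mat d n" and U: "U \<in> carrier_mat n m"
      and u: "u \<in> carrier_vec n" and H: "H \<in> carrier_mat m m" and c: "c \<in> carrier_vec m"
      and R: "R \<in> carrier_mat n m" and ur: "0 < ur" and \<epsilon>: "0 < \<epsilon>" "\<epsilon> < 1"
      and orth: "spectral_norm (mat_adjoint (\<Omega> * U) * (\<Omega> * U) - 1\<^sub>m m) \<le> C_orth * ur"
      and nU: "spectral_norm U \<le> sqrt (1 + \<epsilon>)"
      and nX: "spectral_norm (pseudoinverse U) \<le> 1 / sqrt (1 - \<epsilon>)"
      and unit: "\<bar>euclid_norm u - 1\<bar> \<le> C_unit * ur"
      and coef: "euclid_norm (pseudoinverse U *\<^sub>v u) \<le> C_coef * (ur / sqrt (1 - \<epsilon>))"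
      and rel: "A * U = U * H + col_mat u * mat_adjoint (col_mat c) + R"
      and nR: "spectral_norm R \<le> C_res * (kappa_eps \<epsilon> * sqrt (1 + \<epsilon>) * spectral_norm A * ur)"
      and nc: "euclid_norm c \<le> C_c * (sqrt (1 + \<epsilon>) * spectral_norm A)"
      and small: "kappa_eps \<epsilon> * ur \<le> \<delta>"
    \<comment> \<open>The common small parameter; since \<open>kappa_eps \<epsilon>\<close> is at
      least 1, every bound in \<open>ur\<close> is also one in \<open>t\<close>.\<close>
    define t where "t = kappa_eps \<epsilon> * ur"
    have t: "0 < t" "ur \<le> t" "t \<le> \<delta>"
      using ur small kappa_eps_ge_1[OF \<epsilon>] mult_right_mono[of 1 "kappa_eps \<epsilon>" ur]
      by (auto simp: t_def)
    have "(1 + \<bar>C_orth\<bar> + \<bar>C_unit\<bar> + \<bar>C_coef\<bar>) * t \<le> 1 / 2"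
      unfolding half[symmetric] using t by (intro mult_left_mono) auto
    then have sum: "t + \<bar>C_orth\<bar> * t + \<bar>C_unit\<bar> * t + \<bar>C_coef\<bar> * t \<le> 1 / 2"
      by (simp add: algebra_simps)
    have nonneg: "0 \<le> \<bar>C_orth\<bar> * t" "0 \<le> \<bar>C_unit\<bar> * t" "0 \<le> \<bar>C_coef\<bar> * t"
      using t by auto
    have O_ur: "C * ur \<le> \<bar>C\<bar> * t" for C :: real
      using ur t by (intro mult_mono) auto
    define X where "X = pseudoinverse U"
    have \<Omega>U: "\<Omega> * U \<in> carrier_mat d m" using \<Omega> U by auto
    have lt1: "spectral_norm (mat_adjoint (\<Omega> * U) * (\<Omega> * U) - 1\<^sub>m m) < 1"
      using orth O_ur[of C_orth] sum nonneg t by linarith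
    \<comment> \<open>A kernel vector of \<open>U\<close> is also one of the sketched matrix
      \<open>\<Omega> * U\<close>, which is injective by \<open>lt1\<close>.\<close>
    have inj: "v = 0\<^sub>v m" if v: "v \<in> carrier_vec m" and Uv: "U *\<^sub>v v = 0\<^sub>v n" for v
    proof -
      have "\<Omega> *\<^sub>v 0\<^sub>v n = 0\<^sub>v d" using \<Omega> by auto
      then have "\<Omega> * U *\<^sub>v v = 0\<^sub>v d" using \<Omega> U v Uv by simp
      then show ?thesis by (rule injective_if_near_identity[OF \<Omega>U lt1 v])
    qed
    have X: "is_pseudoinverse U X" and XU: "X * U = 1\<^sub>m m"
      unfolding X_def using pseudoinverse_full_column_rank[OF U inj] by auto
    have X': "X \<in> carrier_mat m n" using X U by (auto simp: is_pseudoinverse_def)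
    \<comment> \<open>The bounds on \<open>U\<close> and on the coefficients contribute the
      numerator and the denominator of \<open>kappa_eps \<epsilon>\<close>.\<close>
    have "spectral_norm U * euclid_norm (X *\<^sub>v u) \<le> sqrt (1 + \<epsilon>) * (C_coef * (ur / sqrt (1 - \<epsilon>)))"
      using \<epsilon> by (intro mult_mono nU coef[folded X_def]) auto
    also have "\<dots> = C_coef * t" by (simp add: t_def kappa_eps_def)
    also have "\<dots> \<le> \<bar>C_coef\<bar> * t" using t by (intro mult_right_mono) auto
    finally have b: "spectral_norm U * euclid_norm (X *\<^sub>v u) \<le> \<bar>C_coef\<bar> * t" .
    have a: "\<bar>euclid_norm u - 1\<bar> \<le> \<bar>C_unit\<bar> * t" using unit O_ur[of C_unit] by linarith
    have "\<bar>C_unit\<bar> * t + \<bar>C_coef\<bar> * t < 1" using sum nonneg t by linarith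
    from orthogonalize_normalize[OF U u X a b this]
    obtain u' where u': "u' \<in> carrier_vec n" "euclid_norm u' = 1" "mat_adjoint U *\<^sub>v u' = 0\<^sub>v m"
      and "euclid_norm (u' - u) \<le> \<bar>C_unit\<bar> * t + 2 * (\<bar>C_coef\<bar> * t)" by blast
    then have du: "euclid_norm (u' - u) \<le> K * t" by (simp add: K_def algebra_simps)
    from backward_error[OF A U H u u'(1) c R X' XU rel]
    obtain E where E: "E \<in> carrier_mat n n"
      "(A + E) * U = U * H + col_mat u' * mat_adjoint (col_mat c)"
      and nE: "spectral_norm E
        \<le> (euclid_norm (u' - u) * euclid_norm c + spectral_norm R) * spectral_norm X" by blast
    \<comment> \<open>The scale shared by the bounds on \<open>c\<close> and \<open>R\<close>; with
      it both parts of the defect are multiples of \<open>s * t\<close>.\<close>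
    define s where "s = sqrt (1 + \<epsilon>) * spectral_norm A"
    have s: "0 \<le> s" using \<epsilon> by (simp add: s_def)
    have "euclid_norm c \<le> \<bar>C_c\<bar> * s"
      using nc mult_right_mono[OF abs_ge_self[of C_c] s] by (simp add: s_def)
    then have "euclid_norm (u' - u) * euclid_norm c \<le> (K * t) * (\<bar>C_c\<bar> * s)"
      using du K t by (intro mult_mono) auto
    moreover have "spectral_norm R \<le> \<bar>C_res\<bar> * (s * t)"
    proof -
      have "spectral_norm R \<le> C_res * (s * t)" using nR by (simp add: s_def t_def mult_ac)
      also have "\<dots> \<le> \<bar>C_res\<bar> * (s * t)" using s t by (intro mult_right_mono) auto
      finally show ?thesis .
    qed
    ultimately have F: "euclid_norm (u' - u) * euclid_norm c + spectral_norm R \<le> K_E * (s * t)"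
      by (simp add: K_E_def algebra_simps)
    \<comment> \<open>The factor from the pseudoinverse combines with
      \<open>sqrt (1 + \<epsilon>)\<close> in \<open>s\<close> to a second
      \<open>kappa_eps \<epsilon>\<close>; the first is inside \<open>t\<close>.\<close>
    have "spectral_norm E \<le> K_E * (s * t) * (1 / sqrt (1 - \<epsilon>))"
      using nE mult_mono[OF F nX[folded X_def]] K_E s t by simp
    also have "\<dots> = K_E * (spectral_norm A * (kappa_eps \<epsilon>)\<^sup>2 * ur)"
      by (simp add: s_def t_def kappa_eps_def power2_eq_square)
    finally have "spectral_norm E \<le> K_E * (spectral_norm A * (kappa_eps \<epsilon>)\<^sup>2 * ur)" .
    then show "\<exists>u'\<in>carrier_vec n. \<exists>E\<in>carrier_mat n n.
         euclid_norm (u' - u) \<le> K * (kappa_eps \<epsilon> * ur) \<and>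
         spectral_norm E \<le> K_E * (spectral_norm A * (kappa_eps \<epsilon>)\<^sup>2 * ur) \<and>
         euclid_norm u' = 1 \<and>
         (A + E) * U = U * H + col_mat u' * mat_adjoint (col_mat c) \<and>
         mat_adjoint U *\<^sub>v u' = 0\<^sub>v m"
      using u' E du unfolding t_def by blast
  qed
qed

end
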